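(* Let $\{F_\theta:\theta\in\Theta\}$ be a standard exponential family generated by $F_0$, with $\Theta=[0,\theta_{\max})$, and for $\theta\in\Theta$ let $X_1,X_2,\dots$ be i.i.d. with law $F_\theta$ under $\mathbb{P}_\theta$. Let $C>0$, $r>0$, $\theta^\ast>0$ with $[0,\theta^\ast]\subset\Theta$ be constants such that for all $b>0$ and $y>0$ $$\sup_{\theta\in[0,\theta^\ast]}\bigl|\mathbb{P}_\theta(R_b\le y)-\mathbb{P}_\theta(R_\infty\le y)\bigr|\le C e^{-r(b+y)} .$$ Define $R_b^{\mathrm{sm}}:=R_b+U$ and $R_\infty^{\mathrm{sm}}:=R_\infty+U$, where $U$ is uniform on $(0,1)$ and independent of all the remaining random quantities. Then for all $b>0$ $$\sup_{\theta\in[0,\theta^\ast]}\bigl\|\mathrm{Law}_\theta(R_b^{\mathrm{sm}})-\mathrm{Law}_\theta(R_\infty^{\mathrm{sm}})\bigr\|_{\mathrm{TV}}\le\sup_{\theta\in[0,\theta^\ast]}W_1(R_b,R_\infty)\le\frac{C}{r}\,e^{-rb}.$$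
   Context: Standard exponential family: $F_0$ is a probability measure on $\mathbb{R}$ and $\Theta=[0,\theta_{\max})$, $\theta_{\max}\in(0,\infty]$, is such that $\int e^{\theta x}F_0(dx)<\infty$ for all $\theta\in\Theta$. Put $\psi(\theta)=\ln\int e^{\theta x}F_0(dx)$ and $F_\theta(dx)=e^{\theta x-\psi(\theta)}F_0(dx)$. The family $\{F_\theta\}$ is called standard if, for $X\sim F_0$, $\mathbb{E}[X]=0$ and $\mathrm{Var}(X)=1$, and $F_0$ is strongly non-lattice, i.e. $\limsup_{|t|\to\infty}\left|\int e^{itx}F_0(dx)\right|<1$. $\mathbb{P}_\theta,\mathbb{E}_\theta$ denote probability and expectation when $X_1,X_2,\dots$ are i.i.d. with law $F_\theta$; $\mathrm{Law}_\theta$ denotes the law under $\mathbb{P}_\theta$. $S_0=0$, $S_n=X_1+\dots+X_n$. For $b\ge 0$: $\tau(b)=\inf\{n\ge1:S_n>b\}$ and the overshoot is $R_b=S_{\tau(b)}-b$. $R_\infty$ denotes a nonnegative random variable whose law under $\mathbb{P}_\theta$ is the weak limit of the law of $R_b$ under $\mathbb{P}_\theta$ as $b\to\infty$ (this limit is known to exist). It is a known result from the literature that constants $C,r,\theta^\ast$ with the assumed uniform estimate exist for every standard exponential family. For real random variables $X,Y$ with finite first moments, $W_1(X,Y)=\inf\{\mathbb{E}|X'-Y'|: X'\stackrel{d}{=}X,\ Y'\stackrel{d}{=}Y\}$, the infimum over all joint constructions (couplings) $(X',Y')$; for each $\theta$, $W_1(R_b,R_\infty)$ is taken for the laws under $\mathbb{P}_\theta$.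 For probability measures $\mu,\nu$ on $\mathbb{R}$, $\|\mu-\nu\|_{\mathrm{TV}}=\sup_A|\mu(A)-\nu(A)|$ over Borel sets $A\subset\mathbb{R}$. *)

theory Defs
  imports "HOL-Probability.Probability"
begin

definition param_space :: "ereal \<Rightarrow> real set" where
  "param_space \<theta>max = {\<theta>. 0 \<le> \<theta> \<and> ereal \<theta> < \<theta>max}"

definition log_mgf :: "real measure \<Rightarrow> real \<Rightarrow> real" where
  "log_mgf F0 \<theta> = ln (\<integral>x. exp (\<theta> * x) \<partial>F0)"

definition exp_tilt :: "real measure \<Rightarrow> real \<Rightarrow> real measure" where
  "exp_tilt F0 \<theta> = density F0 (\<lambda>x. ennreal (exp (\<theta> * x - log_mgf F0 \<theta>)))"

text \<open>
  On the reals the filter \<^const>\<open>at_infinity\<close> is the limit where the absolute value tends to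
  infinity, so the last assumption is the strong non-lattice condition.
\<close>

locale standard_exponential_family = real_distribution F0
  for F0 :: "real measure" +
  fixes \<theta>max :: ereal
  assumes theta_max_pos: "0 < \<theta>max"
    and exp_integrable: "\<theta> \<in> param_space \<theta>max \<Longrightarrow> integrable F0 (\<lambda>x. exp (\<theta> * x))"
    and mean_integrable: "integrable F0 (\<lambda>x. x)"
    and mean_zero: "expectation (\<lambda>x. x) = 0"
    and square_integrable: "integrable F0 (\<lambda>x. x\<^sup>2)"
    and variance_one: "variance (\<lambda>x. x) = 1"
    and strongly_non_lattice: "Limsup at_infinity (\<lambda>t. ereal (cmod (char F0 t))) < 1"

definition partial_sum :: "(nat \<Rightarrow> 'a \<Rightarrow> real) \<Rightarrow> nat \<Rightarrow> 'a \<Rightarrow> real" where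
  "partial_sum X n \<omega> = (\<Sum>i=1..n. X i \<omega>)"

definition passage_time :: "(nat \<Rightarrow> 'a \<Rightarrow> real) \<Rightarrow> real \<Rightarrow> 'a \<Rightarrow> enat" where
  "passage_time X b \<omega> = Inf {enat n |n. 1 \<le> n \<and> partial_sum X n \<omega> > b}"

text \<open>
  The value 0 on the event that the level is never exceeded is a convention; for random walks
  with nonnegative drift and nondegenerate steps this event is null.
\<close>

definition overshoot :: "(nat \<Rightarrow> 'a \<Rightarrow> real) \<Rightarrow> real \<Rightarrow> 'a \<Rightarrow> real" where
  "overshoot X b \<omega> =
     (if passage_time X b \<omega> = \<infinity> then 0
      else partial_sum X (the_enat (passage_time X b \<omega>)) \<omega> - b)"

text \<open>
  A joint construction of two random variables enters only through its joint law, so couplings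
  are represented by measures on the plane with the prescribed marginals.
\<close>

definition couplings :: "real measure \<Rightarrow> real measure \<Rightarrow> (real \<times> real) measure set" where
  "couplings \<mu> \<nu> =
     {\<gamma>. prob_space \<gamma> \<and> sets \<gamma> = sets (borel \<Otimes>\<^sub>M borel) \<and>
         distr \<gamma> borel fst = \<mu> \<and> distr \<gamma> borel snd = \<nu>}"

definition W1 :: "real measure \<Rightarrow> real measure \<Rightarrow> ennreal" where
  "W1 \<mu> \<nu> = (INF \<gamma>\<in>couplings \<mu> \<nu>. \<integral>\<^sup>+ z. ennreal \<bar>fst z - snd z\<bar> \<partial>\<gamma>)"

definition tv_dist :: "real measure \<Rightarrow> real measure \<Rightarrow> ennreal" where
  "tv_dist \<mu> \<nu> = (SUP A\<in>sets borel. ennreal \<bar>measure \<mu> A - measure \<nu> A\<bar>)"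

end

(*
  The quantile coupling (both laws realised on the unit interval by their generalised inverse
  distribution functions) has transport cost equal to the integral of the distance between the
  distribution functions, so W1 is at most the integral of C exp (-r (b + y)) over y > 0.
  For total variation, the probability that x + U lies in A is the Lebesgue measure of
  A \<inter> (x, x + 1) and hence a 1-Lipschitz function of x; its expectations under the two marginals
  of a coupling therefore differ by at most the transport cost of that coupling.
*)
theory Submission
  imports Defs
begin

section \<open>First passage and overshoot of a random walk\<close>

text \<open>A nonempty infimum of extended naturals is attained, so the passage time is a
  \<open>LEAST\<close> over ordinary naturals. Sign, locality and measurability of the overshoot are
  all read off from this form, which no longer mentions \<open>enat\<close>.\<close>

lemma overshoot_eq:
  "overshoot X b \<omega> =
     (if \<exists>n\<ge>1. partial_sum X n \<omega> > b
      then partial_sum X (LEAST n. 1 \<le> n \<and> partial_sum X n \<omega> > b) \<omega> - b else 0)"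
proof (cases "\<exists>n\<ge>1. partial_sum X n \<omega> > b")
  case True
  then have Q: "\<exists>n. 1 \<le> n \<and> partial_sum X n \<omega> > b" by blast
  have "passage_time X b \<omega> = enat (LEAST n. 1 \<le> n \<and> partial_sum X n \<omega> > b)"
    unfolding passage_time_def
  proof (rule antisym)
    show "Inf {enat n |n. 1 \<le> n \<and> partial_sum X n \<omega> > b}
        \<le> enat (LEAST n. 1 \<le> n \<and> partial_sum X n \<omega> > b)"
      using LeastI_ex[OF Q] by (intro Inf_lower) blast
    show "enat (LEAST n. 1 \<le> n \<and> partial_sum X n \<omega> > b)
        \<le> Inf {enat n |n. 1 \<le> n \<and> partial_sum X n \<omega> > b}"
      by (rule Inf_greatest) (auto intro!: Least_le)
  qed
  then show ?thesis using True by (simp add: overshoot_def)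
next
  case False
  then have "{enat n |n. 1 \<le> n \<and> partial_sum X n \<omega> > b} = {}" by auto
  then have "passage_time X b \<omega> = \<infinity>"
    by (simp only: passage_time_def Inf_empty top_enat_def)
  then show ?thesis using False unfolding overshoot_def by (simp only: refl if_True if_False)
qed

lemma overshoot_nonneg: "0 \<le> overshoot X b \<omega>"
proof (cases "\<exists>n\<ge>1. partial_sum X n \<omega> > b")
  case True
  then have Q: "\<exists>n. 1 \<le> n \<and> partial_sum X n \<omega> > b" by blast
  show ?thesis using LeastI_ex[OF Q] True by (auto simp: overshoot_eq)
qed (simp only: overshoot_eq if_False order_refl)

text \<open>The sums start at index 1, so only these steps matter. The two sample points may lie in
  different spaces, which later allows the walk to be replaced by the coordinate process on a
  product space.\<close>

lemma overshoot_cong: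
  assumes "\<And>i. 1 \<le> i \<Longrightarrow> X i \<omega> = Y i \<omega>'"
  shows "overshoot X b \<omega> = overshoot Y b \<omega>'"
proof -
  have "partial_sum X n \<omega> = partial_sum Y n \<omega>'" for n
    unfolding partial_sum_def by (rule sum.cong) (auto simp: assms)
  then show ?thesis by (simp only: overshoot_eq)
qed

lemma measurable_overshoot:
  assumes X: "\<And>i. 1 \<le> i \<Longrightarrow> X i \<in> borel_measurable M"
  shows "overshoot X b \<in> borel_measurable M"
proof -
  have [measurable]: "partial_sum X n \<in> borel_measurable M" for n
    unfolding partial_sum_def using X by (intro borel_measurable_sum) auto
  have "(\<lambda>\<omega>. partial_sum X (LEAST n. 1 \<le> n \<and> partial_sum X n \<omega> > b) \<omega>) \<in> borel_measurable M"
    \<comment> \<open>The random index takes countably many values and each partial sum is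
      measurable.\<close>
    by (rule measurable_compose_countable) measurable
  then show ?thesis
    unfolding overshoot_eq[abs_def] by measurable
qed

section \<open>Transport cost and distribution functions\<close>

lemma W1_le_nn_integral_cdf:
  assumes \<mu>: "real_distribution \<mu>" and \<nu>: "real_distribution \<nu>"
  shows "W1 \<mu> \<nu> \<le> (\<integral>\<^sup>+x. ennreal \<bar>cdf \<mu> x - cdf \<nu> x\<bar> \<partial>lborel)"
proof -
  interpret \<mu>: cdf_distribution \<mu> unfolding cdf_distribution_def by (rule \<mu>)
  interpret \<nu>: cdf_distribution \<nu> unfolding cdf_distribution_def by (rule \<nu>)
  let ?\<Omega> = "restrict_space lborel {0<..<1::real}"
  let ?\<gamma> = "distr ?\<Omega> (borel \<Otimes>\<^sub>M borel) (\<lambda>u. (\<mu>.I u, \<nu>.I u))"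
  \<comment> \<open>Indicator of the region between the graphs of the two distribution functions.
    Its sections at fixed \<open>u\<close> have the distance of the quantiles as length, those at
    fixed \<open>x\<close> the distance of the distribution functions, so Fubini turns one integral
    into the other.\<close>
  let ?D = "\<lambda>u x. (if 0 < u \<and> u < 1 \<and> (u \<le> \<mu>.C x) \<noteq> (u \<le> \<nu>.C x) then 1 else 0 :: ennreal)"
  interpret \<Omega>: prob_space ?\<Omega>
    by (auto simp add: emeasure_restrict_space space_restrict_space intro!: prob_spaceI)
  have [measurable]: "\<mu>.I \<in> borel_measurable ?\<Omega>" "\<nu>.I \<in> borel_measurable ?\<Omega>"
    using \<mu>.measurable_CI \<nu>.measurable_CI
    by (simp_all cong: measurable_cong_sets add: sets_restrict_space)
  have "prob_space ?\<gamma>"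
    by (rule \<Omega>.prob_space_distr) measurable
  moreover have "distr ?\<gamma> borel fst = \<mu>" "distr ?\<gamma> borel snd = \<nu>"
    using \<mu>.distr_I_eq_M \<nu>.distr_I_eq_M by (simp_all add: distr_distr o_def)
  ultimately have "?\<gamma> \<in> couplings \<mu> \<nu>"
    by (simp add: couplings_def)
  then have "W1 \<mu> \<nu> \<le> (\<integral>\<^sup>+ z. ennreal \<bar>fst z - snd z\<bar> \<partial>?\<gamma>)"
    unfolding W1_def by (rule INF_lower)
  also have "\<dots> = (\<integral>\<^sup>+ u. ennreal \<bar>\<mu>.I u - \<nu>.I u\<bar> \<partial>?\<Omega>)"
    by (simp add: nn_integral_distr)
  also have "\<dots> = (\<integral>\<^sup>+ u. ennreal \<bar>\<mu>.I u - \<nu>.I u\<bar> * indicator {0<..<1} u \<partial>lborel)"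
    by (simp add: nn_integral_restrict_space)
  also have "\<dots> = (\<integral>\<^sup>+ u. \<integral>\<^sup>+ x. ?D u x \<partial>lborel \<partial>lborel)"
  proof (rule nn_integral_cong)
    fix u :: real
    show "ennreal \<bar>\<mu>.I u - \<nu>.I u\<bar> * indicator {0<..<1} u = (\<integral>\<^sup>+ x. ?D u x \<partial>lborel)"
    proof (cases "0 < u \<and> u < 1")
      case True
      \<comment> \<open>The quantile function satisfies \<open>u \<le> \<mu>.C x\<close> iff
        \<open>\<mu>.I u \<le> x\<close> for \<open>u\<close> in the open unit interval. At least
        one of the two half-open intervals is empty.\<close>
      then have "?D u x = indicator ({\<mu>.I u..<\<nu>.I u} \<union> {\<nu>.I u..<\<mu>.I u}) x" for x
        using \<mu>.pseudoinverse[of u x] \<nu>.pseudoinverse[of u x]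
        by (auto split: split_indicator)
      then have "(\<integral>\<^sup>+ x. ?D u x \<partial>lborel)
          = emeasure lborel ({\<mu>.I u..<\<nu>.I u} \<union> {\<nu>.I u..<\<mu>.I u})"
        by simp
      also have "\<dots> = ennreal \<bar>\<mu>.I u - \<nu>.I u\<bar>"
        by (cases "\<mu>.I u \<le> \<nu>.I u") simp_all
      finally show ?thesis using True by simp
    qed auto
  qed
  also have "\<dots> = (\<integral>\<^sup>+ x. \<integral>\<^sup>+ u. ?D u x \<partial>lborel \<partial>lborel)"
    by (rule lborel_pair.Fubini') measurable
  also have "\<dots> \<le> (\<integral>\<^sup>+x. ennreal \<bar>cdf \<mu> x - cdf \<nu> x\<bar> \<partial>lborel)"
  proof (rule nn_integral_mono)
    fix x :: real
    \<comment> \<open>Dropping the restriction \<open>0 < u < 1\<close> can only enlarge the set,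
      whence an inequality here.\<close>
    have "(\<integral>\<^sup>+ u. ?D u x \<partial>lborel)
        \<le> (\<integral>\<^sup>+ u. indicator ({\<mu>.C x<..\<nu>.C x} \<union> {\<nu>.C x<..\<mu>.C x}) u \<partial>lborel)"
      by (rule nn_integral_mono) (auto split: split_indicator)
    also have "\<dots> = emeasure lborel ({\<mu>.C x<..\<nu>.C x} \<union> {\<nu>.C x<..\<mu>.C x})"
      by simp
    also have "\<dots> = ennreal \<bar>cdf \<mu> x - cdf \<nu> x\<bar>"
      by (cases "\<mu>.C x \<le> \<nu>.C x") simp_all
    finally show "(\<integral>\<^sup>+ u. ?D u x \<partial>lborel) \<le> ennreal \<bar>cdf \<mu> x - cdf \<nu> x\<bar>" .
  qed
  finally show ?thesis .
qed

section \<open>Uniform smoothing and total variation\<close>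

lemma emeasure_unit_interval_shift_le:
  fixes x y :: real
  assumes A[measurable]: "A \<in> sets borel"
  shows "emeasure lborel (A \<inter> {x<..<x+1}) \<le> emeasure lborel (A \<inter> {y<..<y+1}) + ennreal \<bar>x - y\<bar>"
proof -
  \<comment> \<open>\<open>?J\<close> covers the part of the window at \<open>x\<close> that sticks
    out of the window at \<open>y\<close>: on the left if \<open>x \<le> y\<close>, on the right
    otherwise. This remains true when the windows are disjoint.\<close>
  let ?J = "if x \<le> y then {x..y} else {y+1..x+1}"
  have "A \<inter> {x<..<x+1} \<subseteq> (A \<inter> {y<..<y+1}) \<union> ?J" by auto
  then have "emeasure lborel (A \<inter> {x<..<x+1}) \<le> emeasure lborel ((A \<inter> {y<..<y+1}) \<union> ?J)"
    by (rule emeasure_mono) simp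
  also have "\<dots> \<le> emeasure lborel (A \<inter> {y<..<y+1}) + emeasure lborel ?J"
    by (rule emeasure_subadditive) simp_all
  also have "emeasure lborel ?J = ennreal \<bar>x - y\<bar>" by simp
  finally show ?thesis .
qed

text \<open>Translation invariance of Lebesgue measure, together with the unit interval having
  length 1. The set on the left is the one that appears in the formula for the measure of a
  convolution.\<close>

lemma emeasure_uniform_translate:
  fixes x :: real
  assumes A[measurable]: "A \<in> sets borel"
  shows "emeasure (uniform_measure lborel {0<..<1}) {a. a + x \<in> A}
       = emeasure lborel (A \<inter> {x<..<x+1})"
proof -
  have [measurable]: "{a. a + x \<in> A} \<in> sets borel" by measurable
  have "emeasure lborel (A \<inter> {x<..<x+1}) = emeasure (distr lborel borel ((+) x)) (A \<inter> {x<..<x+1})"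
    by (simp add: lborel_distr_plus)
  also have "\<dots> = emeasure lborel ((+) x -` (A \<inter> {x<..<x+1}))"
    by (simp add: emeasure_distr)
  also have "(+) x -` (A \<inter> {x<..<x+1}) = {0<..<1} \<inter> {a. a + x \<in> A}"
    by (auto simp: add.commute)
  finally show ?thesis by (simp add: divide_ennreal_def)
qed

text \<open>Two one-sided bounds replace the absolute value, since subtraction in
  \<open>ennreal\<close> is truncated. For infinite \<open>w\<close> the claim is trivial; for
  finite \<open>w\<close> everything is moved to the reals.\<close>

lemma tv_dist_le:
  assumes \<mu>: "prob_space \<mu>" and \<nu>: "prob_space \<nu>"
    and le: "\<And>A. A \<in> sets borel \<Longrightarrow> emeasure \<mu> A \<le> emeasure \<nu> A + w"
      "\<And>A. A \<in> sets borel \<Longrightarrow> emeasure \<nu> A \<le> emeasure \<mu> A + w"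
  shows "tv_dist \<mu> \<nu> \<le> w"
  unfolding tv_dist_def
proof (rule SUP_least)
  fix A :: "real set" assume A: "A \<in> sets borel"
  interpret \<mu>: prob_space \<mu> by (rule \<mu>)
  interpret \<nu>: prob_space \<nu> by (rule \<nu>)
  show "ennreal \<bar>measure \<mu> A - measure \<nu> A\<bar> \<le> w"
  proof (cases w)
    case (real v)
    then have "measure \<mu> A \<le> measure \<nu> A + v" "measure \<nu> A \<le> measure \<mu> A + v"
      using le[OF A]
      by (simp_all add: \<mu>.emeasure_eq_measure \<nu>.emeasure_eq_measure ennreal_plus[symmetric]
            del: ennreal_plus)
    then show ?thesis using real by (auto intro!: ennreal_leI)
  qed simp
qed

text \<open>Both marginal integrals become integrals over the joint law, where the Lipschitz bound
  is integrated pointwise. Using it in both directions gives the two inequalities.\<close>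

lemma coupling_le:
  assumes \<gamma>: "\<gamma> \<in> couplings \<mu> \<nu>"
    and f[measurable]: "f \<in> borel_measurable borel"
    and lip: "\<And>x y. f x \<le> f y + ennreal \<bar>x - y\<bar>"
  shows "(\<integral>\<^sup>+x. f x \<partial>\<mu>) \<le> (\<integral>\<^sup>+x. f x \<partial>\<nu>) + (\<integral>\<^sup>+ z. ennreal \<bar>fst z - snd z\<bar> \<partial>\<gamma>)"
    and "(\<integral>\<^sup>+x. f x \<partial>\<nu>) \<le> (\<integral>\<^sup>+x. f x \<partial>\<mu>) + (\<integral>\<^sup>+ z. ennreal \<bar>fst z - snd z\<bar> \<partial>\<gamma>)"
proof -
  have [measurable_cong]: "sets \<gamma> = sets (borel \<Otimes>\<^sub>M borel)"
    and \<mu>: "\<mu> = distr \<gamma> borel fst" and \<nu>: "\<nu> = distr \<gamma> borel snd"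
    using \<gamma> by (auto simp: couplings_def)
  have m: "(\<integral>\<^sup>+x. f x \<partial>\<mu>) = (\<integral>\<^sup>+z. f (fst z) \<partial>\<gamma>)" "(\<integral>\<^sup>+x. f x \<partial>\<nu>) = (\<integral>\<^sup>+z. f (snd z) \<partial>\<gamma>)"
    unfolding \<mu> \<nu> by (auto intro!: nn_integral_distr)
  have "(\<integral>\<^sup>+z. f (fst z) \<partial>\<gamma>) \<le> (\<integral>\<^sup>+z. f (snd z) + ennreal \<bar>fst z - snd z\<bar> \<partial>\<gamma>)"
    by (rule nn_integral_mono) (rule lip)
  then show "(\<integral>\<^sup>+x. f x \<partial>\<mu>) \<le> (\<integral>\<^sup>+x. f x \<partial>\<nu>) + (\<integral>\<^sup>+ z. ennreal \<bar>fst z - snd z\<bar> \<partial>\<gamma>)"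
    unfolding m by (simp add: nn_integral_add)
  have "(\<integral>\<^sup>+z. f (snd z) \<partial>\<gamma>) \<le> (\<integral>\<^sup>+z. f (fst z) + ennreal \<bar>fst z - snd z\<bar> \<partial>\<gamma>)"
    using lip[of "snd z" "fst z" for z] by (intro nn_integral_mono) (simp add: abs_minus_commute)
  then show "(\<integral>\<^sup>+x. f x \<partial>\<nu>) \<le> (\<integral>\<^sup>+x. f x \<partial>\<mu>) + (\<integral>\<^sup>+ z. ennreal \<bar>fst z - snd z\<bar> \<partial>\<gamma>)"
    unfolding m by (simp add: nn_integral_add)
qed

text \<open>Convolution is the law of a sum of independent variables, so smoothing by
  \<open>U\<close> can be treated through laws alone. The bound holds for each coupling and hence
  for the infimum.\<close>

lemma tv_dist_convolution_uniform_le_W1: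
  assumes \<mu>: "real_distribution \<mu>" and \<nu>: "real_distribution \<nu>"
  shows "tv_dist (\<mu> \<star> uniform_measure lborel {0<..<1}) (\<nu> \<star> uniform_measure lborel {0<..<1})
      \<le> W1 \<mu> \<nu>"
proof -
  let ?U = "uniform_measure lborel {0<..<1::real}"
  interpret \<mu>: real_distribution \<mu> by (rule \<mu>)
  interpret \<nu>: real_distribution \<nu> by (rule \<nu>)
  interpret U: prob_space ?U by (rule prob_space_uniform_measure) simp_all
  have em: "emeasure (\<kappa> \<star> ?U) A = (\<integral>\<^sup>+x. emeasure lborel (A \<inter> {x<..<x+1}) \<partial>\<kappa>)"
    if "real_distribution \<kappa>" "A \<in> sets borel" for \<kappa> A
  proof -
    interpret \<kappa>: real_distribution \<kappa> by (rule that)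
    have "emeasure (\<kappa> \<star> ?U) A = (\<integral>\<^sup>+x. emeasure ?U {a. a + x \<in> A} \<partial>\<kappa>)"
      using that(2) by (intro convolution_emeasure) (auto simp: \<kappa>.finite_measure_axioms U.finite_measure_axioms)
    then show ?thesis by (simp add: emeasure_uniform_translate[OF that(2)])
  qed
  have p: "prob_space (\<kappa> \<star> ?U)" if "real_distribution \<kappa>" for \<kappa>
  proof -
    interpret \<kappa>: real_distribution \<kappa> by (rule that)
    interpret pair_prob_space \<kappa> ?U ..
    show ?thesis unfolding convolution_def by (rule prob_space_distr) measurable
  qed
  show ?thesis
    unfolding W1_def
  proof (rule INF_greatest)
    fix \<gamma> assume \<gamma>: "\<gamma> \<in> couplings \<mu> \<nu>"
    have meas: "(\<lambda>x. emeasure lborel (A \<inter> {x<..<x+1})) \<in> borel_measurable borel"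
      if [measurable]: "A \<in> sets borel" for A :: "real set"
    proof -
      \<comment> \<open>The window length depends measurably on \<open>x\<close> as a parameter
        integral of a jointly measurable function.\<close>
      have "(\<lambda>x. \<integral>\<^sup>+ a. (if a \<in> A \<and> x < a \<and> a < x + 1 then 1 else 0) \<partial>lborel)
          \<in> borel_measurable borel"
        by measurable
      also have "(\<lambda>x. \<integral>\<^sup>+ a. (if a \<in> A \<and> x < a \<and> a < x + 1 then 1 else 0) \<partial>lborel)
          = (\<lambda>x. \<integral>\<^sup>+ a. indicator (A \<inter> {x<..<x+1}) a \<partial>lborel)"
        by (intro ext nn_integral_cong) (auto split: split_indicator)
      finally show ?thesis by simp
    qed
    show "tv_dist (\<mu> \<star> ?U) (\<nu> \<star> ?U) \<le> (\<integral>\<^sup>+ z. ennreal \<bar>fst z - snd z\<bar> \<partial>\<gamma>)"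
      using coupling_le[OF \<gamma> meas emeasure_unit_interval_shift_le]
      by (intro tv_dist_le p \<mu> \<nu>) (simp_all add: em[OF \<mu>] em[OF \<nu>])
  qed
qed

section \<open>Independence under measurable maps\<close>

text \<open>The variable \<open>f (V \<omega>)\<close> generates a sub-sigma-algebra of the one
  generated by \<open>V\<close>, and independence passes to sub-sigma-algebras. It serves to extract
  the independence of \<open>U\<close> from the overshoot and from the limit variable out of one
  joint hypothesis.\<close>

lemma (in prob_space) indep_var_of_indep_set_vimage_algebra:
  assumes V: "V \<in> measurable M S" and U: "U \<in> measurable M T" and f: "f \<in> measurable S N"
    and ind: "indep_set (sets (vimage_algebra (space M) V S)) (sets (vimage_algebra (space M) U T))"
  shows "indep_var N (\<lambda>\<omega>. f (V \<omega>)) T U"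
proof -
  let ?G = "{(\<lambda>\<omega>. f (V \<omega>)) -` A \<inter> space M | A. A \<in> sets N}"
  have "V \<in> space M \<rightarrow> space S" using measurable_space[OF V] by blast
  then have "(\<lambda>\<omega>. f (V \<omega>)) \<in> measurable (vimage_algebra (space M) V S) N"
    by (intro measurable_compose[OF measurable_vimage_algebra1 f])
  from measurable_sets[OF this] have "?G \<subseteq> sets (vimage_algebra (space M) V S)"
    by auto
  then have "sigma_sets (space M) ?G \<subseteq> sets (vimage_algebra (space M) V S)"
    using sets.sigma_sets_subset[of ?G "vimage_algebra (space M) V S"] by simp
  then have "indep_set (sigma_sets (space M) ?G) (sets (vimage_algebra (space M) U T))"
    using ind unfolding indep_set_def by (rule_tac indep_sets_mono_sets) (auto split: bool.split)
  then show ?thesis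
    using measurable_compose[OF V f] U unfolding indep_var_eq by (simp add: sets_vimage_algebra)
qed

section \<open>Integration of the exponential tail\<close>

lemma W1_le_exponential_tail:
  assumes \<mu>: "real_distribution \<mu>" and \<nu>: "real_distribution \<nu>"
    and neg: "\<And>x. x < 0 \<Longrightarrow> cdf \<mu> x = 0" "\<And>x. x < 0 \<Longrightarrow> cdf \<nu> x = 0"
    and K: "0 \<le> K" and r: "0 < r"
    and pos: "\<And>x. 0 < x \<Longrightarrow> \<bar>cdf \<mu> x - cdf \<nu> x\<bar> \<le> K * exp (- r * x)"
  shows "W1 \<mu> \<nu> \<le> ennreal (K / r)"
proof -
  have "W1 \<mu> \<nu> \<le> (\<integral>\<^sup>+x. ennreal \<bar>cdf \<mu> x - cdf \<nu> x\<bar> \<partial>lborel)"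
    by (rule W1_le_nn_integral_cdf[OF \<mu> \<nu>])
  also have "\<dots> \<le> (\<integral>\<^sup>+x. ennreal (K * exp (- r * x)) * indicator {0..} x \<partial>lborel)"
  proof (rule nn_integral_mono_AE)
    show "AE x in lborel. ennreal \<bar>cdf \<mu> x - cdf \<nu> x\<bar>
        \<le> ennreal (K * exp (- r * x)) * indicator {0..} x"
      \<comment> \<open>The assumptions say nothing about the distribution functions at 0, but a
        single point is a null set.\<close>
      using AE_lborel_singleton[of 0]
    proof eventually_elim
      case (elim x)
      then consider "x < 0" | "0 < x" by linarith
      then show ?case
        by cases (auto simp: neg intro!: ennreal_leI dest: pos)
    qed
  qed
  \<comment> \<open>Value at infinity minus value at 0 of the antiderivative
    \<open>- (K / r) * exp (- r * x)\<close>.\<close>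
  also have "\<dots> = ennreal (0 - (- (K / r) * exp (- r * 0)))"
  proof (rule nn_integral_FTC_atLeast)
    show "((\<lambda>x. - (K / r) * exp (- r * x)) has_real_derivative K * exp (- r * x)) (at x)" for x
      using r by (auto intro!: derivative_eq_intros)
    have "((\<lambda>x. exp (- r * x)) \<longlongrightarrow> 0) at_top"
      using r by (intro filterlim_compose[OF exp_at_bot]
        filterlim_tendsto_neg_mult_at_bot[OF tendsto_const _ filterlim_ident]) auto
    then show "((\<lambda>x. - (K / r) * exp (- r * x)) \<longlongrightarrow> 0) at_top"
      by (rule tendsto_mult_right_zero)
  qed (use K in auto)
  finally show ?thesis by simp
qed

section \<open>The comparison uniform in the parameter\<close>

theorem corollary5:
  fixes F0 :: "real measure" and \<theta>max :: ereal
    and P :: "real \<Rightarrow> 'a measure"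
    and X :: "nat \<Rightarrow> 'a \<Rightarrow> real" and Rinf U :: "'a \<Rightarrow> real"
    and C r \<theta>s :: real
  assumes "standard_exponential_family F0 \<theta>max"
    and "\<And>\<theta>. \<theta> \<in> param_space \<theta>max \<Longrightarrow> prob_space (P \<theta>)"
    and "\<And>\<theta>. \<theta> \<in> param_space \<theta>max \<Longrightarrow>
           prob_space.indep_vars (P \<theta>) (\<lambda>_. borel) X {1..}"
    and "\<And>\<theta> i. \<theta> \<in> param_space \<theta>max \<Longrightarrow> 1 \<le> i \<Longrightarrow>
           distr (P \<theta>) borel (X i) = exp_tilt F0 \<theta>"
    and "\<And>\<theta>. \<theta> \<in> param_space \<theta>max \<Longrightarrow> Rinf \<in> borel_measurable (P \<theta>)"
    and "\<And>\<theta>. \<theta> \<in> param_space \<theta>max \<Longrightarrow> AE \<omega> in P \<theta>. 0 \<le> Rinf \<omega>"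
    and "\<And>\<theta> \<beta>. \<theta> \<in> param_space \<theta>max \<Longrightarrow> filterlim \<beta> at_top sequentially \<Longrightarrow>
           weak_conv_m (\<lambda>n. distr (P \<theta>) borel (overshoot X (\<beta> n))) (distr (P \<theta>) borel Rinf)"
    and "\<And>\<theta>. \<theta> \<in> param_space \<theta>max \<Longrightarrow> U \<in> borel_measurable (P \<theta>)"
    and "\<And>\<theta>. \<theta> \<in> param_space \<theta>max \<Longrightarrow>
           distr (P \<theta>) borel U = uniform_measure lborel {0<..<1}"
    and "\<And>\<theta>. \<theta> \<in> param_space \<theta>max \<Longrightarrow>
           prob_space.indep_set (P \<theta>)
             (sets (vimage_algebra (space (P \<theta>))
               (\<lambda>\<omega>. ((\<lambda>i\<in>{1..}. X i \<omega>), Rinf \<omega>)) ((\<Pi>\<^sub>M i\<in>{1..}. borel) \<Otimes>\<^sub>M borel)))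
             (sets (vimage_algebra (space (P \<theta>)) U borel))"
    and "C > 0" and "r > 0" and "\<theta>s > 0" and "{0..\<theta>s} \<subseteq> param_space \<theta>max"
    and "\<And>b y. b > 0 \<Longrightarrow> y > 0 \<Longrightarrow>
           (SUP \<theta>\<in>{0..\<theta>s}. \<bar>measure (P \<theta>) {\<omega> \<in> space (P \<theta>). overshoot X b \<omega> \<le> y}
                             - measure (P \<theta>) {\<omega> \<in> space (P \<theta>). Rinf \<omega> \<le> y}\<bar>)
             \<le> C * exp (- r * (b + y))"
  shows "\<forall>b>0.
           (SUP \<theta>\<in>{0..\<theta>s}. tv_dist (distr (P \<theta>) borel (\<lambda>\<omega>. overshoot X b \<omega> + U \<omega>))
                                    (distr (P \<theta>) borel (\<lambda>\<omega>. Rinf \<omega> + U \<omega>)))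
             \<le> (SUP \<theta>\<in>{0..\<theta>s}. W1 (distr (P \<theta>) borel (overshoot X b)) (distr (P \<theta>) borel Rinf))
         \<and> (SUP \<theta>\<in>{0..\<theta>s}. W1 (distr (P \<theta>) borel (overshoot X b)) (distr (P \<theta>) borel Rinf))
             \<le> ennreal (C / r * exp (- r * b))"
proof (intro allI impI conjI)
  fix b :: real assume b: "b > 0"
  let ?R = "overshoot X b"
  \<comment> \<open>Both inequalities are proved for each fixed parameter; the suprema are taken
    only at the end.\<close>
  have facts: "tv_dist (distr (P \<theta>) borel (\<lambda>\<omega>. ?R \<omega> + U \<omega>)) (distr (P \<theta>) borel (\<lambda>\<omega>. Rinf \<omega> + U \<omega>))
        \<le> W1 (distr (P \<theta>) borel ?R) (distr (P \<theta>) borel Rinf) \<and>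
      W1 (distr (P \<theta>) borel ?R) (distr (P \<theta>) borel Rinf) \<le> ennreal (C / r * exp (- r * b))"
    if \<theta>: "\<theta> \<in> {0..\<theta>s}" for \<theta>
  proof -
    have \<Theta>: "\<theta> \<in> param_space \<theta>max" using assms(14) \<theta> by blast
    interpret prob_space "P \<theta>" by (rule assms(2)[OF \<Theta>])
    have X[measurable]: "X i \<in> borel_measurable (P \<theta>)" if "1 \<le> i" for i
      using assms(3)[OF \<Theta>] that unfolding indep_vars_def by auto
    have R[measurable]: "?R \<in> borel_measurable (P \<theta>)"
      by (rule measurable_overshoot) (rule X)
    note [measurable] = assms(5)[OF \<Theta>] assms(8)[OF \<Theta>]
    have rd: "real_distribution (distr (P \<theta>) borel Y)" if "Y \<in> borel_measurable (P \<theta>)" for Y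
      using that by (rule real_distribution_distr)
    have cdf: "cdf (distr (P \<theta>) borel Y) x = measure (P \<theta>) {\<omega> \<in> space (P \<theta>). Y \<omega> \<le> x}"
      if [measurable]: "Y \<in> borel_measurable (P \<theta>)" for Y x
      unfolding cdf_def by (simp add: measure_distr) (rule arg_cong[where f = prob], auto)
    let ?S = "(\<Pi>\<^sub>M i\<in>{1::nat..}. (borel :: real measure)) \<Otimes>\<^sub>M (borel :: real measure)"
    let ?V = "\<lambda>\<omega>. ((\<lambda>i\<in>{1..}. X i \<omega>), Rinf \<omega>)"
    have V: "?V \<in> measurable (P \<theta>) ?S"
      by (intro measurable_Pair measurable_restrict X) (auto simp: assms(5)[OF \<Theta>])
    note ind = indep_var_of_indep_set_vimage_algebra[OF V assms(8)[OF \<Theta>] _ assms(10)[OF \<Theta>]]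
    \<comment> \<open>The overshoot of the coordinate process is a measurable function on the
      product space; composed with \<open>?V\<close> it gives back \<open>?R\<close>, so the
      independence of \<open>U\<close> from \<open>?V\<close> applies.\<close>
    have "overshoot (\<lambda>i z. fst z i) b \<in> borel_measurable ?S"
      by (rule measurable_overshoot) measurable
    moreover have "overshoot (\<lambda>i z. fst z i) b (?V \<omega>) = ?R \<omega>" for \<omega>
      by (rule overshoot_cong) simp
    ultimately have indR: "indep_var borel ?R borel U"
      using ind[of "overshoot (\<lambda>i z. fst z i) b" borel] by simp
    have indRinf: "indep_var borel Rinf borel U"
      using ind[OF measurable_snd] by simp
    have tv: "tv_dist (distr (P \<theta>) borel (\<lambda>\<omega>. ?R \<omega> + U \<omega>)) (distr (P \<theta>) borel (\<lambda>\<omega>. Rinf \<omega> + U \<omega>))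
        \<le> W1 (distr (P \<theta>) borel ?R) (distr (P \<theta>) borel Rinf)"
      using tv_dist_convolution_uniform_le_W1[OF rd rd, of ?R Rinf]
      by (simp add: sum_indep_random_variable[OF indR] sum_indep_random_variable[OF indRinf]
            assms(9)[OF \<Theta>])
    \<comment> \<open>The tail bound is applied with \<open>K = C * exp (- r * b)\<close>.\<close>
    have "W1 (distr (P \<theta>) borel ?R) (distr (P \<theta>) borel Rinf) \<le> ennreal (C * exp (- r * b) / r)"
    proof (rule W1_le_exponential_tail)
      fix x :: real assume x: "x < 0"
      have "{\<omega> \<in> space (P \<theta>). ?R \<omega> \<le> x} = {}"
        using x overshoot_nonneg[of X b] by (auto simp: not_le intro: less_le_trans)
      then show "cdf (distr (P \<theta>) borel ?R) x = 0"
        by (simp only: cdf[OF R] measure_empty)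
      \<comment> \<open>\<open>Rinf\<close> is nonnegative only almost surely, so this event is null
        rather than empty.\<close>
      have "prob {\<omega> \<in> space (P \<theta>). Rinf \<omega> \<le> x} = 0"
        using assms(6)[OF \<Theta>] x by (subst prob_eq_0) (auto elim!: eventually_mono)
      then show "cdf (distr (P \<theta>) borel Rinf) x = 0"
        by (subst cdf) auto
    next
      fix x :: real assume x: "0 < x"
      let ?d = "\<lambda>\<theta>. \<bar>measure (P \<theta>) {\<omega> \<in> space (P \<theta>). ?R \<omega> \<le> x}
                   - measure (P \<theta>) {\<omega> \<in> space (P \<theta>). Rinf \<omega> \<le> x}\<bar>"
      \<comment> \<open>The supremum in the assumed estimate is one of reals, and it dominates its
        terms only if they are bounded; differences of probabilities are at most 1.\<close>
      have "bdd_above (?d ` {0..\<theta>s})"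
      proof (rule bdd_aboveI2)
        fix t assume "t \<in> {0..\<theta>s}"
        then interpret t: prob_space "P t" using assms(2,14) by blast
        show "?d t \<le> 1"
          using t.prob_le_1[of "{\<omega> \<in> space (P t). ?R \<omega> \<le> x}"]
            t.prob_le_1[of "{\<omega> \<in> space (P t). Rinf \<omega> \<le> x}"]
          by (smt (verit) measure_nonneg)
      qed
      then have "?d \<theta> \<le> (SUP \<theta>\<in>{0..\<theta>s}. ?d \<theta>)" by (intro cSUP_upper \<theta>)
      also have "\<dots> \<le> C * exp (- r * (b + x))" by (rule assms(15)[OF b x])
      also have "\<dots> = C * exp (- r * b) * exp (- r * x)"
        by (simp add: exp_add[symmetric] algebra_simps)
      finally show "\<bar>cdf (distr (P \<theta>) borel ?R) x - cdf (distr (P \<theta>) borel Rinf) x\<bar>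
          \<le> C * exp (- r * b) * exp (- r * x)"
        by (simp add: cdf R)
    qed (use assms(11,12) rd in auto)
    then show ?thesis using tv by simp
  qed
  show "(SUP \<theta>\<in>{0..\<theta>s}. tv_dist (distr (P \<theta>) borel (\<lambda>\<omega>. ?R \<omega> + U \<omega>))
            (distr (P \<theta>) borel (\<lambda>\<omega>. Rinf \<omega> + U \<omega>)))
      \<le> (SUP \<theta>\<in>{0..\<theta>s}. W1 (distr (P \<theta>) borel ?R) (distr (P \<theta>) borel Rinf))"
    using facts by (intro SUP_mono) blast
  show "(SUP \<theta>\<in>{0..\<theta>s}. W1 (distr (P \<theta>) borel ?R) (distr (P \<theta>) borel Rinf))
      \<le> ennreal (C / r * exp (- r * b))"
    using facts by (intro SUP_least) blast
qed

end
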